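(* Let $n,f$ be integers with $1\le f\le n-1$ and $\Pi$ a set of $n$ processes. The following algorithm, using the oracle $\mathcal O.\mathrm{Cons}(\Pi,f)$, solves $(f+1)\text{-TAg}(\Pi,f)$: each process $p$ sends its initial value $v_p$ to all processes, waits until it has received initial values from $n-f$ processes, sets $x_p$ to the minimum of the values received, queries $\mathcal O.\mathrm{Cons}(\Pi,f)$ with $x_p$, and decides the value answered by the oracle. In particular $(f+1)\text{-TAg}(n,f)$ is $C$-reducible to $\mathrm{Cons}(n,f)$ (and hence, for every $k\in\{f+1,\dots,n\}$, $k\text{-TAg}(n,f)$ is equivalent to $\mathrm{Cons}(n,f)$ with respect to $C$-reducibility).
   Context: Model: a finite set of processes runs an asynchronous algorithm communicating by reliable message passing with unbounded delays and speeds; processes fail only by crashing. Time is $\mathcal T=\mathbb N$; a failure pattern $F$ for $\Pi$ is a nondecreasing map $\mathcal T\to2^\Pi$, $Faulty(F)=\bigcup_tF(t)$. A binary agreement problem $P$ for $\Pi$ maps each $(F,\vec V)$, $\vec V\in\{0,1\}^\Pi$, to a nonempty $P(F,\vec V)\subseteq\{0,1\}$; a task is $T=(P,f)$. An algorithm solves $T$ if in every run with $|Faulty(F)|\le f$ and initial values $\vec V$: every correct process eventually decides, decisions are irrevocable, no two processes decide differently, and decisions lie in $P(F,\vec V)$. $k\text{-TAg}_\Pi(F,\vec V)=\{0\}$ if at least $k$ entries of $\vec V$ are $0$; $=\{1\}$ if $\vec V$ is all-ones and $|Faulty(F)|\le k-1$; $=\{0,1\}$ otherwise; $k\text{-TAg}(\Pi,f)=(k\text{-TAg}_\Pi,f)$;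 $\mathrm{Cons}(\Pi,f)=|\Pi|\text{-TAg}(\Pi,f)$; $k\text{-TAg}(n,f)$, $\mathrm{Cons}(n,f)$ denote the versions for $\Pi=\{1,\dots,n\}$. Oracles: for $T=(P,f)$ on $\Pi$, $\mathcal O.T$ is a black box with consultants $\Pi$; its history is a sequence of successive consultations, in each of which every consultant may submit at most one query in $\{0,1\}$ and the oracle returns a common response $d$ with $d\in P(F,\vec V)$ for every $\vec V$ extending the partial query vector (the oracle may use the whole failure pattern, including future crashes), and every correct querier gets the response whenever at least $|\Pi|-f$ consultants query; $\mathcal O.T$ is the most general such oracle. $T_1\le_C T_2$ means there is an algorithm solving $T_1$ whose processes may additionally consult the oracle $\mathcal O.T_2$ (for a renamed copy of $T_2$ on the relevant processes). *)

theory Defs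
  imports Main
begin

text \<open>Binary values are naturals in {0,1}; a value vector is a map 'p => nat, only its
  entries on Pi matter.\<close>

definition failure_pattern :: "'p set \<Rightarrow> (nat \<Rightarrow> 'p set) \<Rightarrow> bool" where
  "failure_pattern Pi F \<longleftrightarrow> mono F \<and> (\<forall>t. F t \<subseteq> Pi)"

definition faulty :: "(nat \<Rightarrow> 'p set) \<Rightarrow> 'p set" where
  "faulty F = (\<Union>t. F t)"

definition binvec :: "'p set \<Rightarrow> ('p \<Rightarrow> nat) \<Rightarrow> bool" where
  "binvec Pi V \<longleftrightarrow> (\<forall>p\<in>Pi. V p \<in> {0, 1})"

definition TAg :: "nat \<Rightarrow> 'p set \<Rightarrow> (nat \<Rightarrow> 'p set) \<Rightarrow> ('p \<Rightarrow> nat) \<Rightarrow> nat set" where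
  "TAg k Pi F V =
     (if k \<le> card {p\<in>Pi. V p = 0} then {0}
      else if (\<forall>p\<in>Pi. V p = 1) \<and> card (faulty F) \<le> k - 1 then {1}
      else {0, 1})"

definition ConsP :: "'p set \<Rightarrow> (nat \<Rightarrow> 'p set) \<Rightarrow> ('p \<Rightarrow> nat) \<Rightarrow> nat set" where
  "ConsP Pi = TAg (card Pi) Pi"

definition received :: "('p \<Rightarrow> 'p \<Rightarrow> nat option) \<Rightarrow> 'p \<Rightarrow> nat \<Rightarrow> 'p set" where
  "received dlv p t = {q. \<exists>s. dlv p q = Some s \<and> s \<le> t}"

text \<open>A run of the algorithm of the theorem (send initial value to all, wait for n-f
  values, query O.Cons(Pi,f) with their minimum, decide the oracle's answer), in the
  asynchronous crash-prone model with reliable links and the oracle O.Cons(Pi,f):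
  \<^item> sendT p = Some t : p broadcasts its initial value at time t (p alive then);
  \<^item> dlv p q = Some t : the message of q is delivered to p at time t (p alive then);
  \<^item> qry p = Some (t, x) : p submits query x to the oracle at time t;
  \<^item> resp p = Some t : p receives the oracle's (common) response d at time t;
  and p decides d when it receives the response.
  The oracle O.Cons(Pi,f) is used in a single consultation (each process queries
  at most once); its response d must lie in Cons_Pi(F,W) for every binary W extending
  the query vector, and if at least n-f consultants query, every correct querier gets
  the response.  Correct processes take infinitely many steps (fairness): a correct
  process sends, and queries once it has received n-f values.\<close>
definition alg_run ::
  "'p set \<Rightarrow> nat \<Rightarrow> (nat \<Rightarrow> 'p set) \<Rightarrow> ('p \<Rightarrow> nat) \<Rightarrow> ('p \<Rightarrow> nat option) \<Rightarrow>
   ('p \<Rightarrow> 'p \<Rightarrow> nat option) \<Rightarrow> ('p \<Rightarrow> (nat \<times> nat) option) \<Rightarrow> ('p \<Rightarrow> nat option) \<Rightarrow> nat \<Rightarrow> bool"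
where
  "alg_run Pi f F V sendT dlv qry resp d \<longleftrightarrow>
     \<comment> \<open>only processes of Pi act\<close>
     (\<forall>p. p \<notin> Pi \<longrightarrow> sendT p = None \<and> qry p = None \<and> resp p = None \<and>
                     (\<forall>q. dlv p q = None \<and> dlv q p = None)) \<and>
     \<comment> \<open>a process sends only while alive; correct processes send\<close>
     (\<forall>p t. sendT p = Some t \<longrightarrow> p \<notin> F t) \<and>
     (\<forall>p\<in>Pi. p \<notin> faulty F \<longrightarrow> sendT p \<noteq> None) \<and>
     \<comment> \<open>no creation of messages; receiver alive at reception\<close>
     (\<forall>p q t. dlv p q = Some t \<longrightarrow> p \<notin> F t \<and> (\<exists>s. sendT q = Some s \<and> s \<le> t)) \<and>
     \<comment> \<open>reliable links: messages sent to correct processes are delivered\<close>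
     (\<forall>p\<in>Pi. \<forall>q. p \<notin> faulty F \<longrightarrow> sendT q \<noteq> None \<longrightarrow> dlv p q \<noteq> None) \<and>
     \<comment> \<open>query only after sending and after receiving n-f values; query = min of received values\<close>
     (\<forall>p t x. qry p = Some (t, x) \<longrightarrow>
         p \<notin> F t \<and> (\<exists>s. sendT p = Some s \<and> s \<le> t) \<and>
         card Pi - f \<le> card (received dlv p t) \<and> x = Min (V ` received dlv p t)) \<and>
     \<comment> \<open>fairness: a correct process that has received n-f values queries\<close>
     (\<forall>p\<in>Pi. p \<notin> faulty F \<longrightarrow> (\<exists>t. card Pi - f \<le> card (received dlv p t)) \<longrightarrow> qry p \<noteq> None) \<and>
     \<comment> \<open>responses only go to queriers, after their query, while alive\<close>
     (\<forall>p t. resp p = Some t \<longrightarrow> p \<notin> F t \<and> (\<exists>s x. qry p = Some (s, x) \<and> s \<le> t)) \<and>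
     \<comment> \<open>oracle safety: d is allowed by Cons for every completion of the query vector\<close>
     (\<forall>W. binvec Pi W \<longrightarrow> (\<forall>p s x. qry p = Some (s, x) \<longrightarrow> W p = x) \<longrightarrow> d \<in> ConsP Pi F W) \<and>
     \<comment> \<open>oracle liveness: if at least n-f consultants query, every correct querier gets d\<close>
     (card Pi - f \<le> card {p\<in>Pi. qry p \<noteq> None} \<longrightarrow>
        (\<forall>p\<in>Pi. p \<notin> faulty F \<longrightarrow> qry p \<noteq> None \<longrightarrow> resp p \<noteq> None))"

definition decision :: "('p \<Rightarrow> nat option) \<Rightarrow> nat \<Rightarrow> 'p \<Rightarrow> nat option" where
  "decision resp d p = (if resp p = None then None else Some d)"

text \<open>Correctness conditions of "solving" the problem P in a run with decisions dec
  (decisions are single values, hence irrevocable).\<close>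
definition solves_in_run ::
  "'p set \<Rightarrow> ((nat \<Rightarrow> 'p set) \<Rightarrow> ('p \<Rightarrow> nat) \<Rightarrow> nat set) \<Rightarrow> (nat \<Rightarrow> 'p set) \<Rightarrow> ('p \<Rightarrow> nat) \<Rightarrow>
   ('p \<Rightarrow> nat option) \<Rightarrow> bool" where
  "solves_in_run Pi P F V dec \<longleftrightarrow>
     (\<forall>p\<in>Pi. p \<notin> faulty F \<longrightarrow> dec p \<noteq> None) \<and>
     (\<forall>p q a b. dec p = Some a \<longrightarrow> dec q = Some b \<longrightarrow> a = b) \<and>
     (\<forall>p a. dec p = Some a \<longrightarrow> a \<in> P F V)"

end

theory Submission
  imports Defs
begin

(* Every correct process hears from all n - f correct processes, so at least n - f processes
   query and the oracle answers every correct querier.  A query is the minimum of n - f received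
   values.  If at least f + 1 initial values are 0, each set of n - f senders contains a 0, so all
   queries are 0 and Cons, applied to the all-zero vector (which extends the query vector),
   forces the answer 0.  If all initial values are 1, all queries are 1 and, since fewer than
   n processes crash, Cons forces the answer 1.  Otherwise any binary answer is allowed by (f+1)-TAg. *)

lemma TAg_subset: "TAg k Pi F V \<subseteq> {0, 1}"
  by (auto simp: TAg_def)

lemma ConsP_const_zero: "ConsP Pi F (\<lambda>_. 0) = {0}"
  by (simp add: ConsP_def TAg_def)

lemma ConsP_const_one:
  assumes "finite Pi" and "Pi \<noteq> {}" and "card (faulty F) < card Pi"
  shows "ConsP Pi F (\<lambda>_. 1) = {1}"
proof -
  have "0 < card Pi" using assms(1,2) by (simp add: card_gt_0_iff)
  then show ?thesis using assms(3) by (simp add: ConsP_def TAg_def)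
qed

lemma Int_nonempty_if_card_sum_gt:
  assumes "finite S" and "A \<subseteq> S" and "B \<subseteq> S" and "card S < card A + card B"
  shows "A \<inter> B \<noteq> {}"
proof
  assume "A \<inter> B = {}"
  have "finite A" "finite B" using assms(1-3) finite_subset by auto
  then have "card A + card B = card (A \<union> B)"
    using \<open>A \<inter> B = {}\<close> by (simp add: card_Un_disjoint)
  also have "\<dots> \<le> card S" using assms(1-3) by (intro card_mono) auto
  finally show False using assms(4) by simp
qed

locale min_query_run =
  fixes Pi :: "'p set" and f :: nat and F V sendT dlv qry resp and d :: nat
  assumes finite_Pi: "finite Pi"
    and f_less_card: "f < card Pi"
    and failure_pattern: "failure_pattern Pi F"
    and card_faulty_le: "card (faulty F) \<le> f"
    and binary_values: "binvec Pi V"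
    and run: "alg_run Pi f F V sendT dlv qry resp d"
begin

lemma received_subset: "received dlv p t \<subseteq> Pi"
proof
  fix q assume "q \<in> received dlv p t"
  then have "dlv p q \<noteq> None" unfolding received_def by auto
  then show "q \<in> Pi" using run unfolding alg_run_def by metis
qed

lemma finite_received: "finite (received dlv p t)"
  using received_subset finite_Pi finite_subset by blast

lemma correct_sends: "p \<in> Pi - faulty F \<Longrightarrow> sendT p \<noteq> None"
  using run unfolding alg_run_def by blast

lemma reliable_delivery:
  "p \<in> Pi - faulty F \<Longrightarrow> sendT q \<noteq> None \<Longrightarrow> dlv p q \<noteq> None"
  using run unfolding alg_run_def by blast

lemma query_received:
  assumes "qry p = Some (t, x)"
  shows "card Pi - f \<le> card (received dlv p t)" and "x = Min (V ` received dlv p t)"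
  using run assms unfolding alg_run_def by blast+

lemma correct_queries_when_enough_received:
  "p \<in> Pi - faulty F \<Longrightarrow> card Pi - f \<le> card (received dlv p t) \<Longrightarrow> qry p \<noteq> None"
  using run unfolding alg_run_def by blast

lemma oracle_safety:
  "binvec Pi W \<Longrightarrow> (\<And>p s x. qry p = Some (s, x) \<Longrightarrow> W p = x) \<Longrightarrow> d \<in> ConsP Pi F W"
  using run unfolding alg_run_def by blast

lemma oracle_liveness:
  "card Pi - f \<le> card {q\<in>Pi. qry q \<noteq> None} \<Longrightarrow> p \<in> Pi - faulty F \<Longrightarrow> qry p \<noteq> None
   \<Longrightarrow> resp p \<noteq> None"
  using run unfolding alg_run_def by blast

lemma query_in_received_values:
  assumes "qry p = Some (t, x)"
  shows "x \<in> V ` received dlv p t"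
proof -
  have "received dlv p t \<noteq> {}"
    using query_received(1)[OF assms] f_less_card by auto
  then show ?thesis
    using query_received(2)[OF assms] finite_received by simp
qed

lemma query_binary:
  assumes "qry p = Some (t, x)"
  shows "x \<in> {0, 1}"
proof -
  obtain q where "q \<in> received dlv p t" and "x = V q"
    using query_in_received_values[OF assms] by blast
  then have "q \<in> Pi" using received_subset by blast
  then show ?thesis using \<open>x = V q\<close> binary_values unfolding binvec_def by simp
qed

lemma query_zero_if_many_zeros:
  assumes zeros: "f + 1 \<le> card {q\<in>Pi. V q = 0}" and "qry p = Some (t, x)"
  shows "x = 0"
proof -
  have "card Pi < card {q\<in>Pi. V q = 0} + card (received dlv p t)"
    using zeros query_received(1)[OF assms(2)] f_less_card by linarith
  then have "{q\<in>Pi. V q = 0} \<inter> received dlv p t \<noteq> {}"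
    by (intro Int_nonempty_if_card_sum_gt[OF finite_Pi _ received_subset]) auto
  then obtain q where "q \<in> received dlv p t" and "V q = 0" by blast
  then have "Min (V ` received dlv p t) \<le> V q"
    using finite_received by (intro Min_le) auto
  then show ?thesis using query_received(2)[OF assms(2)] \<open>V q = 0\<close> by simp
qed

lemma query_one_if_all_ones:
  assumes "\<forall>q\<in>Pi. V q = 1" and "qry p = Some (t, x)"
  shows "x = 1"
proof -
  obtain q where "q \<in> received dlv p t" and "x = V q"
    using query_in_received_values[OF assms(2)] by blast
  then show ?thesis using received_subset assms(1) by auto
qed

lemma oracle_answer_if_unanimous:
  assumes "c \<in> {0, 1}" and "\<And>p t x. qry p = Some (t, x) \<Longrightarrow> x = c"
  shows "d \<in> ConsP Pi F (\<lambda>_. c)"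
  using assms by (intro oracle_safety) (auto simp: binvec_def)

lemma oracle_answer_binary: "d \<in> {0, 1}"
proof -
  define W where "W p = (case qry p of None \<Rightarrow> 0 | Some (_, x) \<Rightarrow> x)" for p
  have "binvec Pi W"
    unfolding binvec_def W_def using query_binary by (auto split: option.split)
  then have "d \<in> ConsP Pi F W"
    by (rule oracle_safety) (simp add: W_def)
  then show ?thesis using TAg_subset unfolding ConsP_def by blast
qed

lemma card_correct: "card Pi - f \<le> card (Pi - faulty F)"
proof -
  have "faulty F \<subseteq> Pi"
    using failure_pattern unfolding failure_pattern_def faulty_def by blast
  then have "card (Pi - faulty F) = card Pi - card (faulty F)"
    using finite_Pi finite_subset by (blast intro: card_Diff_subset)
  then show ?thesis using card_faulty_le by simp
qed

lemma correct_receives_enough: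
  assumes "p \<in> Pi - faulty F"
  shows "\<exists>t. card Pi - f \<le> card (received dlv p t)"
proof -
  have "\<forall>q\<in>Pi - faulty F. \<exists>s. dlv p q = Some s"
    using assms correct_sends reliable_delivery by blast
  then obtain g where g: "\<forall>q\<in>Pi - faulty F. dlv p q = Some (g q)" by metis
  have "Pi - faulty F \<subseteq> received dlv p (Max (g ` (Pi - faulty F)))"
    unfolding received_def using g finite_Pi by auto
  then have "card (Pi - faulty F) \<le> card (received dlv p (Max (g ` (Pi - faulty F))))"
    using finite_received by (rule card_mono[rotated])
  then show ?thesis using card_correct by (meson le_trans)
qed

lemma correct_queries:
  assumes "p \<in> Pi - faulty F"
  shows "qry p \<noteq> None"
  using assms correct_receives_enough[OF assms] correct_queries_when_enough_received by blast

lemma correct_receives_answer: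
  assumes "p \<in> Pi - faulty F"
  shows "resp p \<noteq> None"
proof -
  have "card (Pi - faulty F) \<le> card {q\<in>Pi. qry q \<noteq> None}"
    using correct_queries finite_Pi by (intro card_mono) auto
  then have "card Pi - f \<le> card {q\<in>Pi. qry q \<noteq> None}"
    using card_correct by linarith
  then show ?thesis
    using assms correct_queries[OF assms] oracle_liveness by blast
qed

lemma oracle_answer_valid: "d \<in> TAg (f + 1) Pi F V"
proof (cases "f + 1 \<le> card {q\<in>Pi. V q = 0}")
  case True
  have "d \<in> ConsP Pi F (\<lambda>_. 0)"
    using query_zero_if_many_zeros[OF True] by (intro oracle_answer_if_unanimous) auto
  then show ?thesis using True by (simp add: ConsP_const_zero TAg_def)
next
  case many_zeros: False
  show ?thesis
  proof (cases "\<forall>q\<in>Pi. V q = 1")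
    case True
    have "d \<in> ConsP Pi F (\<lambda>_. 1)"
      using query_one_if_all_ones[OF True] by (intro oracle_answer_if_unanimous) auto
    moreover have "ConsP Pi F (\<lambda>_. 1) = {1}"
      using f_less_card card_faulty_le by (intro ConsP_const_one finite_Pi) auto
    ultimately show ?thesis
      using True card_faulty_le many_zeros by (simp add: TAg_def)
  next
    case False
    then show ?thesis using many_zeros oracle_answer_binary by (auto simp: TAg_def)
  qed
qed

theorem solves_TAg: "solves_in_run Pi (TAg (f + 1) Pi) F V (decision resp d)"
  unfolding solves_in_run_def
proof (intro conjI ballI allI impI)
  fix p assume "p \<in> Pi" and "p \<notin> faulty F"
  then show "decision resp d p \<noteq> None"
    using correct_receives_answer[of p] by (simp add: decision_def)
next
  fix p q a b assume "decision resp d p = Some a" and "decision resp d q = Some b"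
  then show "a = b" by (simp add: decision_def split: if_splits)
next
  fix p a assume "decision resp d p = Some a"
  then show "a \<in> TAg (f + 1) Pi F V"
    using oracle_answer_valid by (simp add: decision_def split: if_splits)
qed

end

theorem mainTheorem5:
  fixes Pi :: "'p set" and n f :: nat
  assumes "finite Pi" and "card Pi = n" and "1 \<le> f" and "f \<le> n - 1"
    and "failure_pattern Pi F" and "card (faulty F) \<le> f"
    and "binvec Pi V"
    and "alg_run Pi f F V sendT dlv qry resp d"
  shows "solves_in_run Pi (TAg (f + 1) Pi) F V (decision resp d)"
proof -
  have "f < card Pi" using assms(2-4) by linarith
  then interpret min_query_run Pi f F V sendT dlv qry resp d
    using assms by unfold_locales
  show ?thesis by (rule solves_TAg)
qed

end
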